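(* Let $m\ge0$ be an integer, let $n=2m+1$, and set $$\Psi_m(q)=\sum_{k=0}^{m}(-1)^k(2k+1)q^{k(k+1)/2}.$$ If $q\in\mathbb C$, $q\ne0$ and $\Psi_m(q)=0$, then $q\in\operatorname{Spec}_{2m+1}$. More precisely, $x=-q^{-(m+1)}$ is a multiple zero of the polynomial $x\mapsto\Theta_{2m+1}(q,x)$.
   Context: For an integer $n\ge0$, the degree $n$ truncation of the partial theta function is $\Theta_n(q,x)=\sum_{j=0}^{n}q^{j(j+1)/2}x^j$, and $$\operatorname{Spec}_n=\{q\in\mathbb C\setminus\{0\}:\ \operatorname{disc}_x\Theta_n(q,x)=0\},$$ where $\operatorname{disc}_x$ is the discriminant with respect to $x$. *)

theory Defs
  imports Complex_Main "Subresultants.Resultant_Prelim"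
begin

definition theta_trunc :: "nat \<Rightarrow> complex \<Rightarrow> complex poly" where
  "theta_trunc n q = (\<Sum>j\<le>n. monom (q ^ (j * (j + 1) div 2)) j)"

lemma poly_theta_trunc:
  "poly (theta_trunc n q) x = (\<Sum>j\<le>n. q ^ (j * (j + 1) div 2) * x ^ j)"
  by (simp add: theta_trunc_def poly_sum poly_monom)

text \<open>
  Normalisation \<open>disc p = (-1)^(d(d-1)/2) Res(p, p') / a\<close>, where \<open>d\<close> is the degree and
  \<open>a\<close> the leading coefficient of \<open>p\<close>. Characteristic 0 ensures \<open>deg p' = d - 1\<close>,
  so that the resultant has the size required by this formula.
\<close>
definition discriminant :: "'a :: field_char_0 poly \<Rightarrow> 'a" where
  "discriminant p =
     (-1) ^ (degree p * (degree p - 1) div 2) * resultant p (pderiv p) / lead_coeff p"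

text \<open>
  For \<open>q \<noteq> 0\<close> the leading coefficient \<open>q^(n(n+1)/2)\<close> does not vanish, so the
  discriminant in \<open>x\<close> may be computed after specialising \<open>q\<close>.
\<close>
definition Spec :: "nat \<Rightarrow> complex set" where
  "Spec n = {q. q \<noteq> 0 \<and> discriminant (theta_trunc n q) = 0}"

definition Psi :: "nat \<Rightarrow> complex \<Rightarrow> complex" where
  "Psi m q = (\<Sum>k\<le>m. (-1) ^ k * of_nat (2 * k + 1) * q ^ (k * (k + 1) div 2))"

end

theory Submission
  imports Defs "Subresultants.Subresultant_Gcd"
    "HOL-Computational_Algebra.Field_as_Ring"
begin

text \<open>
  Put \<open>x = -q^{-(m+1)}\<close>. The exponent of \<open>q\<close> in the \<open>j\<close>-th term
  \<open>c\<^sub>j = q^{j(j+1)/2} x^j\<close> of the truncated theta function becomes \<open>j(j-2m-1)/2\<close>, which is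
  invariant under \<open>j \<mapsto> 2m+1-j\<close>; the sign \<open>(-1)^j\<close> changes under this reflection because
  \<open>2m+1\<close> is odd. So the terms cancel in pairs (\<open>theta_term_reflect\<close>), and \<open>x\<close> is a zero for
  every \<open>q \<noteq> 0\<close>.

  The same pairing applied to \<open>x \<Theta>'(x)\<close>, the sum of the \<open>j c\<^sub>j\<close>, leaves from the indices \<open>m-k\<close>
  and \<open>m+1+k\<close> the contribution \<open>-(2k+1) c\<^bsub>m-k\<^esub>\<close>. Since \<open>c\<^bsub>m-k\<^esub>\<close> is \<open>(-1)^k q^{k(k+1)/2}\<close>
  times a factor independent of \<open>k\<close> (\<open>theta_term_lower\<close>), the derivative is a nonzero multiple of
  \<open>\<Psi>\<^sub>m(q)\<close>. Its vanishing makes \<open>x\<close> a multiple zero. A multiple zero is a common zero of the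
  polynomial and its derivative, which forces their resultant, hence the discriminant, to vanish.
\<close>

text \<open>
  With \<open>m = k + d\<close>, the numbers \<open>d\<close> and \<open>2k+d+1\<close> are the indices \<open>m-k\<close> and \<open>m+1+k\<close>, which the
  reflection \<open>j \<mapsto> 2m+1-j\<close> exchanges. Naming the difference \<open>d\<close> avoids truncated subtraction.
\<close>

lemma triangle_reflect:
  fixes k d :: nat
  defines "T \<equiv> \<lambda>n::nat. n * (n + 1) div 2"
  shows "T (2 * k + d + 1) = T d + (k + d + 1) * (2 * k + 1)"
proof -
  have T: "2 * T n = n * (n + 1)" for n
    by (simp add: T_def)
  have "2 * T (2 * k + d + 1) = 2 * T d + 2 * ((k + d + 1) * (2 * k + 1))"
    unfolding T by (simp add: algebra_simps)
  then show ?thesis by linarith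
qed

lemma triangle_complement:
  fixes k d :: nat
  defines "T \<equiv> \<lambda>n::nat. n * (n + 1) div 2"
  shows "T d + T (k + d) = T k + (k + d + 1) * d"
proof -
  have T: "2 * T n = n * (n + 1)" for n
    by (simp add: T_def)
  have "2 * T d + 2 * T (k + d) = 2 * T k + 2 * ((k + d + 1) * d)"
    unfolding T by (simp add: algebra_simps)
  then show ?thesis by linarith
qed

text \<open>
  The point \<open>x = -q^{-(m+1)}\<close> enters only through \<open>x q^{m+1} = -1\<close>, which avoids negative powers.
  The two reflected terms differ by the factor \<open>(x q^{m+1})^{2k+1}\<close>, an odd power of \<open>-1\<close>.
\<close>

lemma theta_term_reflect:
  fixes q x :: "'a :: comm_ring_1"
  assumes x: "x * q ^ (m + 1) = -1" and k: "k \<le> m"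
  defines "c \<equiv> \<lambda>j. q ^ (j * (j + 1) div 2) * x ^ j"
  shows "c (m + 1 + k) = - c (m - k)"
proof -
  define d where "d = m - k"
  have m: "m = k + d" using k by (simp add: d_def)
  have "c (m + 1 + k) = q ^ (d * (d + 1) div 2 + (m + 1) * (2 * k + 1)) * x ^ (d + (2 * k + 1))"
    unfolding c_def m triangle_reflect[symmetric] by (simp add: mult_2 add_ac)
  also have "\<dots> = c d * (x * q ^ (m + 1)) ^ (2 * k + 1)"
    unfolding c_def power_add power_mult power_mult_distrib by (simp only: mult_ac)
  also have "\<dots> = - c d"
    unfolding x by simp
  finally show ?thesis by (simp add: d_def)
qed

text \<open>
  At \<open>x = -q^{-(m+1)}\<close> the term with index \<open>m-k\<close> has the exponent \<open>k(k+1)/2 - m(m+1)/2\<close>; this is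
  where the triangular exponents of \<open>\<Psi>\<^sub>m\<close> come from.
\<close>

lemma theta_term_lower:
  fixes q x :: "'a :: comm_ring_1"
  assumes x: "x * q ^ (m + 1) = -1" and k: "k \<le> m"
  shows "q ^ (m * (m + 1) div 2) * (q ^ ((m - k) * (m - k + 1) div 2) * x ^ (m - k))
    = (-1) ^ m * ((-1) ^ k * q ^ (k * (k + 1) div 2))"
proof -
  define d where "d = m - k"
  have m: "m = k + d" using k by (simp add: d_def)
  have "q ^ (m * (m + 1) div 2) * (q ^ (d * (d + 1) div 2) * x ^ d)
      = q ^ (d * (d + 1) div 2 + m * (m + 1) div 2) * x ^ d"
    by (simp only: power_add mult_ac)
  also have "\<dots> = q ^ (k * (k + 1) div 2 + (m + 1) * d) * x ^ d"
    unfolding m triangle_complement ..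
  also have "\<dots> = q ^ (k * (k + 1) div 2) * (x * q ^ (m + 1)) ^ d"
    unfolding power_add power_mult power_mult_distrib by (simp only: mult_ac)
  also have "\<dots> = (-1) ^ m * ((-1) ^ k * q ^ (k * (k + 1) div 2))"
    unfolding x by (simp add: m power_add mult_ac flip: mult.assoc power_mult_distrib)
  finally show ?thesis by (simp add: d_def)
qed

lemma sum_atMost_odd_pairs:
  fixes f :: "nat \<Rightarrow> 'a :: comm_monoid_add"
  shows "(\<Sum>j\<le>2 * m + 1. f j) = (\<Sum>k\<le>m. f (m - k) + f (m + 1 + k))"
proof -
  have "(\<Sum>j\<le>2 * m + 1. f j) = (\<Sum>j\<le>m. f j) + (\<Sum>j=m+1..2*m+1. f j)"
    using sum.ub_add_nat[of 0 m f "m + 1"] by (simp add: atLeast0AtMost mult_2)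
  also have "(\<Sum>j\<le>m. f j) = (\<Sum>k\<le>m. f (m - k))"
    by (rule sum.reindex_bij_witness[of _ "\<lambda>k. m - k" "\<lambda>k. m - k"]) auto
  also have "(\<Sum>j=m+1..2*m+1. f j) = (\<Sum>k\<le>m. f (m + 1 + k))"
    by (rule sum.reindex_bij_witness[of _ "\<lambda>k. m + 1 + k" "\<lambda>j. j - (m + 1)"]) auto
  finally show ?thesis by (simp add: sum.distrib)
qed

lemma theta_trunc_odd_zero:
  assumes x: "x * q ^ (m + 1) = -1"
  shows "poly (theta_trunc (2 * m + 1) q) x = 0"
  unfolding poly_theta_trunc sum_atMost_odd_pairs
  by (intro sum.neutral ballI) (simp only: atMost_iff theta_term_reflect[OF x] add.right_inverse)

lemma x_times_pderiv_theta_trunc: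
  "x * poly (pderiv (theta_trunc n q)) x
    = (\<Sum>j\<le>n. of_nat j * (q ^ (j * (j + 1) div 2) * x ^ j))"
proof -
  have "x * (of_nat j * a * x ^ (j - 1)) = of_nat j * (a * x ^ j)" for j and a :: complex
    by (cases j) simp_all
  then show ?thesis
    unfolding theta_trunc_def pderiv_sum pderiv_monom poly_sum poly_monom sum_distrib_left
    by (intro sum.cong refl)
qed

text \<open>
  The coefficient \<open>2k+1\<close> of \<open>\<Psi>\<^sub>m\<close> is the difference of the paired indices \<open>m+1+k\<close> and \<open>m-k\<close>.
  The factor \<open>q^{m(m+1)/2}\<close> clears denominators: at \<open>x = -q^{-(m+1)}\<close> the lowest exponent of \<open>q\<close>
  among the terms is \<open>-m(m+1)/2\<close>.
\<close>

lemma theta_trunc_odd_derivative: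
  assumes x: "x * q ^ (m + 1) = -1"
  shows "q ^ (m * (m + 1) div 2) * (x * poly (pderiv (theta_trunc (2 * m + 1) q)) x)
    = - ((-1) ^ m * Psi m q)"
proof -
  define c where "c j = q ^ (j * (j + 1) div 2) * x ^ j" for j
  define Q where "Q = q ^ (m * (m + 1) div 2)"
  have pair: "Q * (of_nat (m - k) * c (m - k) + of_nat (m + 1 + k) * c (m + 1 + k))
      = - ((-1) ^ m * ((-1) ^ k * of_nat (2 * k + 1) * q ^ (k * (k + 1) div 2)))"
    if k: "k \<le> m" for k
  proof -
    have reflect: "c (m + 1 + k) = - c (m - k)"
      unfolding c_def by (rule theta_term_reflect[OF x k])
    have lower: "Q * c (m - k) = (-1) ^ m * ((-1) ^ k * q ^ (k * (k + 1) div 2))"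
      unfolding c_def Q_def by (rule theta_term_lower[OF x k])
    have "Q * (of_nat (m - k) * c (m - k) + of_nat (m + 1 + k) * c (m + 1 + k))
        = - (of_nat (2 * k + 1) * (Q * c (m - k)))"
      unfolding reflect using k by (simp add: of_nat_diff algebra_simps)
    then show ?thesis
      unfolding lower by (simp only: mult_ac)
  qed
  have "Q * (x * poly (pderiv (theta_trunc (2 * m + 1) q)) x)
      = (\<Sum>k\<le>m. Q * (of_nat (m - k) * c (m - k) + of_nat (m + 1 + k) * c (m + 1 + k)))"
    unfolding x_times_pderiv_theta_trunc sum_atMost_odd_pairs c_def sum_distrib_left ..
  also have "\<dots> = - ((-1) ^ m * Psi m q)"
    unfolding Psi_def sum_distrib_left sum_negf[symmetric]
    by (intro sum.cong refl pair) simp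
  finally show ?thesis unfolding Q_def .
qed

lemma theta_trunc_nonzero: "theta_trunc n q \<noteq> 0"
proof
  assume "theta_trunc n q = 0"
  then have "poly (theta_trunc n q) 0 = 0" by simp
  then show False by (simp add: poly_0_coeff_0 theta_trunc_def coeff_sum)
qed

lemma order_ge_2I:
  fixes p :: "'a :: field_char_0 poly"
  assumes "p \<noteq> 0" "poly p a = 0" "poly (pderiv p) a = 0"
  shows "2 \<le> order a p"
proof -
  have "pderiv p \<noteq> 0"
  proof
    assume "pderiv p = 0"
    then obtain b where "p = [:b:]" by (auto simp: pderiv_eq_0_iff elim: degree_eq_zeroE)
    with assms show False by simp
  qed
  have "order a p = Suc (order a (pderiv p))"
    by (rule order_pderiv[OF assms(1,2)])
  moreover have "order a (pderiv p) \<noteq> 0"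
    using assms(3) \<open>pderiv p \<noteq> 0\<close> by (simp add: order_root)
  ultimately show ?thesis by simp
qed

lemma resultant_eq_0_if_common_zero:
  fixes f g :: "complex poly"
  assumes "f \<noteq> 0" "poly f a = 0" "poly g a = 0"
  shows "resultant f g = 0"
proof -
  have "[:- a, 1:] dvd gcd f g" using assms by (simp add: poly_eq_0_iff_dvd)
  then have "degree [:- a, 1:] \<le> degree (gcd f g)"
    using assms(1) by (intro dvd_imp_degree_le) auto
  then show ?thesis by (simp add: resultant_0_gcd)
qed

theorem theorem3p1:
  fixes m :: nat and q :: complex
  assumes "q \<noteq> 0" and "Psi m q = 0"
  shows "q \<in> Spec (2 * m + 1) \<and>
         2 \<le> order (- (q powi - int (m + 1))) (theta_trunc (2 * m + 1) q)"
proof -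
  define x where "x = - (q powi - int (m + 1))"
  define p where "p = theta_trunc (2 * m + 1) q"
  have x: "x * q ^ (m + 1) = -1"
    using assms(1) by (simp add: x_def power_int_minus del: of_nat_add of_nat_Suc power_Suc)
  then have "x \<noteq> 0" by auto
  have p: "p \<noteq> 0" "poly p x = 0"
    unfolding p_def by (rule theta_trunc_nonzero, rule theta_trunc_odd_zero[OF x])
  have p': "poly (pderiv p) x = 0"
    using theta_trunc_odd_derivative[OF x] assms \<open>x \<noteq> 0\<close> by (simp add: p_def)
  have "discriminant p = 0"
    using resultant_eq_0_if_common_zero[OF p p'] by (simp add: discriminant_def)
  then have "q \<in> Spec (2 * m + 1)"
    using assms(1) by (simp add: Spec_def p_def)
  moreover have "2 \<le> order x p"
    by (rule order_ge_2I[OF p p'])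
  ultimately show ?thesis unfolding x_def p_def by simp
qed

end
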